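(* Let $n\ge1$, $1\le i\le n$, $m\ge 1$, and let $Q=(q_{s,t})\in B^{i,m}$ be non-zero. Let $k$ be the smallest row index such that row $k$ of $Q$ is non-zero, let $t^Q$ be the smallest column index $p$ with $q_{p,k}\neq0$, and let $R=(r_{s,t})$ be obtained from $Q$ by replacing all entries of row $k$ by $0$. Define $$H=f_k^{\varphi_k}\circ f_{k-1}^{\varphi_{k-1}}\circ\cdots\circ f_{i+1}^{\varphi_{i+1}},\qquad E=e_i^{\epsilon_i-q_{i,k}}\circ e_{i-1}^{\epsilon_{i-1}-q_{i-1,k}}\circ\cdots\circ e_{t^Q+1}^{\epsilon_{t^Q+1}-q_{t^Q+1,k}},$$ $$F=f_{t^Q}^{q_{t^Q,k}}\circ f_{t^Q+1}^{\varphi_{t^Q+1}}\circ\cdots\circ f_i^{\varphi_i}$$ (a composition with empty index range being the identity). Then $\mathcal K^Q:=H\circ E\circ F$ is defined on $R$ and $\mathcal K^Q(R)=Q$.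
   Context: Fix integers $n\ge1$, $1\le i\le n$, $m\ge 1$. $B^{i,m}$ is the set of arrays $A=(a_{p,q})$ of non-negative integers indexed by $1\le p\le i$, $i\le q\le n$, such that $\sum_{r=1}^n a_{\beta(r)}\le m$ for every Dyck path $\beta$; a Dyck path is a sequence of positions $\beta(1)=(1,i),\dots,\beta(n)=(i,n)$ with $\beta(r+1)\in\{(a,b+1),(a+1,b)\}$ whenever $\beta(r)=(a,b)$. The index $q$ is called the row index and $p$ the column index (row $q$ of $A$ is $(a_{1,q},\dots,a_{i,q})$); set $a_{p,q}=0$ outside this range. $B^{i,m}$ is a crystal with operators, for $\ell\in\{1,\dots,n\}$: (i) $\ell=i$: $\varphi_i(A)=m-\sum_{j=1}^{i-1}a_{j,i}-\sum_{j=i}^n a_{i,j}$, $\epsilon_i(A)=a_{i,i}$; $f_i$ increases $a_{i,i}$ by $1$, $e_i$ decreases it by $1$. (ii) $\ell>i$: for $1\le p\le i$ let $T_p=\sum_{j=1}^p a_{j,\ell-1}+\sum_{j=p}^i a_{j,\ell}$, let $p_+$ (resp. $q_+$) be the smallest (resp. largest) $p$ maximizing $T_p$. Then $\varphi_\ell(A)=\sum_{j=1}^{p_+}a_{j,\ell-1}-\sum_{j=1}^{p_+-1}a_{j,\ell}$, $\epsilon_\ell(A)=\sum_{j=q_+}^i a_{j,\ell}-\sum_{j=q_++1}^i a_{j,\ell-1}$; $f_\ell$ decreases $a_{p_+,\ell-1}$ by 1 and increases $a_{p_+,\ell}$ by 1; $e_\ell$ increases $a_{q_+,\ell-1}$ by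 1 and decreases $a_{q_+,\ell}$ by 1. (iii) $\ell<i$: for $i\le p\le n$ let $U_p=\sum_{j=i}^p a_{\ell,j}+\sum_{j=p}^n a_{\ell+1,j}$, let $p_-$ (resp. $q_-$) be the largest (resp. smallest) $p$ maximizing $U_p$. Then $\varphi_\ell(A)=\sum_{j=p_-}^n a_{\ell+1,j}-\sum_{j=p_-+1}^n a_{\ell,j}$, $\epsilon_\ell(A)=\sum_{j=i}^{q_-}a_{\ell,j}-\sum_{j=i}^{q_--1}a_{\ell+1,j}$; $f_\ell$ increases $a_{\ell,p_-}$ by 1 and decreases $a_{\ell+1,p_-}$ by 1; $e_\ell$ decreases $a_{\ell,q_-}$ by 1 and increases $a_{\ell+1,q_-}$ by 1. In all cases $f_\ell(A)=0$ (undefined) if $\varphi_\ell(A)=0$ and $e_\ell(A)=0$ if $\epsilon_\ell(A)=0$. Operator conventions: $f_j^{\varphi_j}$ applied to an element $B$ means $f_j^{\varphi_j(B)}(B)$; $e_j^{\epsilon_j-c}$ applied to $B$ means $e_j^{\epsilon_j(B)-c}(B)$ (required $c\le\epsilon_j(B)$); $f_j^c$ with a fixed integer $c$ means applying $f_j$ $c$ times; composition $\circ$ is applied right to left. *)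

theory Defs
  imports Main
begin

text \<open>An array is a function \<open>A\<close> with \<open>A p q\<close> the entry in column \<open>p\<close> and row \<open>q\<close>, extended
  by \<open>0\<close> outside \<open>{1..i} \<times> {i..n}\<close>. Entries are natural numbers; signed differences of sums
  are taken in \<open>int\<close>.\<close>

type_synonym array = "nat \<Rightarrow> nat \<Rightarrow> nat"

definition dyck_path :: "nat \<Rightarrow> nat \<Rightarrow> (nat \<Rightarrow> nat \<times> nat) \<Rightarrow> bool" where
  "dyck_path n i \<beta> \<longleftrightarrow> \<beta> 1 = (1, i) \<and> \<beta> n = (i, n) \<and>
     (\<forall>r\<in>{1..<n}. \<beta> (r + 1) = (fst (\<beta> r), snd (\<beta> r) + 1) \<or>
                    \<beta> (r + 1) = (fst (\<beta> r) + 1, snd (\<beta> r)))"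

definition crystal_B :: "nat \<Rightarrow> nat \<Rightarrow> nat \<Rightarrow> array set" where
  "crystal_B n i m = {A.
     (\<forall>p q. p \<notin> {1..i} \<or> q \<notin> {i..n} \<longrightarrow> A p q = 0) \<and>
     (\<forall>\<beta>. dyck_path n i \<beta> \<longrightarrow> (\<Sum>r=1..n. A (fst (\<beta> r)) (snd (\<beta> r))) \<le> m)}"

definition T_sum :: "nat \<Rightarrow> nat \<Rightarrow> array \<Rightarrow> nat \<Rightarrow> nat" where
  "T_sum i l A p = (\<Sum>j=1..p. A j (l - 1)) + (\<Sum>j=p..i. A j l)"

definition p_plus :: "nat \<Rightarrow> nat \<Rightarrow> array \<Rightarrow> nat" where
  "p_plus i l A = (LEAST p. is_arg_max (T_sum i l A) (\<lambda>p. p \<in> {1..i}) p)"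

definition q_plus :: "nat \<Rightarrow> nat \<Rightarrow> array \<Rightarrow> nat" where
  "q_plus i l A = (GREATEST p. is_arg_max (T_sum i l A) (\<lambda>p. p \<in> {1..i}) p)"

definition U_sum :: "nat \<Rightarrow> nat \<Rightarrow> nat \<Rightarrow> array \<Rightarrow> nat \<Rightarrow> nat" where
  "U_sum n i l A p = (\<Sum>j=i..p. A l j) + (\<Sum>j=p..n. A (l + 1) j)"

definition p_minus :: "nat \<Rightarrow> nat \<Rightarrow> nat \<Rightarrow> array \<Rightarrow> nat" where
  "p_minus n i l A = (GREATEST p. is_arg_max (U_sum n i l A) (\<lambda>p. p \<in> {i..n}) p)"

definition q_minus :: "nat \<Rightarrow> nat \<Rightarrow> nat \<Rightarrow> array \<Rightarrow> nat" where
  "q_minus n i l A = (LEAST p. is_arg_max (U_sum n i l A) (\<lambda>p. p \<in> {i..n}) p)"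

definition crystal_phi :: "nat \<Rightarrow> nat \<Rightarrow> nat \<Rightarrow> nat \<Rightarrow> array \<Rightarrow> int" where
  "crystal_phi n i m l A =
     (if l = i then
        int m - int (\<Sum>j\<in>{1..<i}. A j i) - int (\<Sum>j=i..n. A i j)
      else if l > i then
        int (\<Sum>j=1..p_plus i l A. A j (l - 1)) - int (\<Sum>j\<in>{1..<p_plus i l A}. A j l)
      else
        int (\<Sum>j=p_minus n i l A..n. A (l + 1) j) - int (\<Sum>j\<in>{p_minus n i l A<..n}. A l j))"

definition crystal_eps :: "nat \<Rightarrow> nat \<Rightarrow> nat \<Rightarrow> array \<Rightarrow> int" where
  "crystal_eps n i l A =
     (if l = i then
        int (A i i)
      else if l > i then
        int (\<Sum>j=q_plus i l A..i. A j l) - int (\<Sum>j\<in>{q_plus i l A<..i}. A j (l - 1))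
      else
        int (\<Sum>j=i..q_minus n i l A. A l j) - int (\<Sum>j\<in>{i..<q_minus n i l A}. A (l + 1) j))"

definition incr :: "nat \<Rightarrow> nat \<Rightarrow> array \<Rightarrow> array" where
  "incr p q A = A(p := (A p)(q := A p q + 1))"

text \<open>An entry is only ever decreased by the operators below when it is positive, so the truncating
  subtraction of \<open>nat\<close> is harmless: if, say, \<open>l > i\<close> and \<open>\<phi>\<^sub>l(A) \<noteq> 0\<close>, then
  \<open>a\<^bsub>p\<^sub>+,l-1\<^esub> > 0\<close>, because \<open>p\<^sub>+\<close> is the smallest maximizer of \<open>T\<close>.\<close>

definition decr :: "nat \<Rightarrow> nat \<Rightarrow> array \<Rightarrow> array" where
  "decr p q A = A(p := (A p)(q := A p q - 1))"

text \<open>The element \<open>0\<close> of the crystal (operator undefined) is rendered by \<open>None\<close>.\<close>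

definition crystal_f :: "nat \<Rightarrow> nat \<Rightarrow> nat \<Rightarrow> nat \<Rightarrow> array \<rightharpoonup> array" where
  "crystal_f n i m l A =
     (if crystal_phi n i m l A = 0 then None
      else if l = i then Some (incr i i A)
      else if l > i then
        (let p = p_plus i l A in Some (incr p l (decr p (l - 1) A)))
      else
        (let p = p_minus n i l A in Some (incr l p (decr (l + 1) p A))))"

definition crystal_e :: "nat \<Rightarrow> nat \<Rightarrow> nat \<Rightarrow> array \<rightharpoonup> array" where
  "crystal_e n i l A =
     (if crystal_eps n i l A = 0 then None
      else if l = i then Some (decr i i A)
      else if l > i then
        (let q = q_plus i l A in Some (incr q (l - 1) (decr q l A)))
      else
        (let q = q_minus n i l A in Some (incr (l + 1) q (decr l q A))))"

definition partial_pow :: "('a \<rightharpoonup> 'a) \<Rightarrow> nat \<Rightarrow> ('a \<rightharpoonup> 'a)" where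
  "partial_pow g c = (((\<circ>\<^sub>m) g) ^^ c) Some"

text \<open>Written order, i.e. \<open>partial_comp [g\<^sub>1, \<dots>, g\<^sub>r] = g\<^sub>1 \<circ> \<dots> \<circ> g\<^sub>r\<close>: the last map of the list
  is applied first.\<close>

definition partial_comp :: "('a \<rightharpoonup> 'a) list \<Rightarrow> ('a \<rightharpoonup> 'a)" where
  "partial_comp gs = foldr (\<circ>\<^sub>m) gs Some"

definition f_phi :: "nat \<Rightarrow> nat \<Rightarrow> nat \<Rightarrow> nat \<Rightarrow> array \<rightharpoonup> array" where
  "f_phi n i m j B = partial_pow (crystal_f n i m j) (nat (crystal_phi n i m j B)) B"

definition e_eps_minus :: "nat \<Rightarrow> nat \<Rightarrow> nat \<Rightarrow> nat \<Rightarrow> array \<rightharpoonup> array" where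
  "e_eps_minus n i c j B =
     (if int c \<le> crystal_eps n i j B
      then partial_pow (crystal_e n i j) (nat (crystal_eps n i j B - int c)) B
      else None)"

definition op_H :: "nat \<Rightarrow> nat \<Rightarrow> nat \<Rightarrow> nat \<Rightarrow> array \<rightharpoonup> array" where
  "op_H n i m k = partial_comp (map (\<lambda>j. f_phi n i m j) (rev [i + 1..<k + 1]))"

definition op_E :: "nat \<Rightarrow> nat \<Rightarrow> nat \<Rightarrow> nat \<Rightarrow> array \<Rightarrow> array \<rightharpoonup> array" where
  "op_E n i k t Q = partial_comp (map (\<lambda>j. e_eps_minus n i (Q j k) j) (rev [t + 1..<i + 1]))"

definition op_F :: "nat \<Rightarrow> nat \<Rightarrow> nat \<Rightarrow> nat \<Rightarrow> nat \<Rightarrow> array \<Rightarrow> array \<rightharpoonup> array" where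
  "op_F n i m k t Q =
     partial_pow (crystal_f n i m t) (Q t k) \<circ>\<^sub>m
     partial_comp (map (\<lambda>j. f_phi n i m j) [t + 1..<i + 1])"

definition first_row :: "array \<Rightarrow> nat" where
  "first_row Q = (LEAST k. \<exists>p. Q p k \<noteq> 0)"

definition first_col :: "array \<Rightarrow> nat" where
  "first_col Q = (LEAST p. Q p (first_row Q) \<noteq> 0)"

definition erase_row :: "nat \<Rightarrow> array \<Rightarrow> array" where
  "erase_row k Q = (\<lambda>p q. if q = k then 0 else Q p q)"

definition op_K :: "nat \<Rightarrow> nat \<Rightarrow> nat \<Rightarrow> array \<Rightarrow> array \<rightharpoonup> array" where
  "op_K n i m Q =
     (let k = first_row Q; t = first_col Q
      in op_H n i m k \<circ>\<^sub>m (op_E n i k t Q \<circ>\<^sub>m op_F n i m k t Q))"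

end

theory Submission
  imports Defs
begin

text \<open>
  Write \<open>q\<^sub>j\<close> for the entries of row \<open>k\<close> of \<open>Q\<close>, and let \<open>X\<close> be \<open>R\<close> with row \<open>i\<close> replaced by
  \<open>(q\<^sub>1, \<dots>, q\<^sub>i)\<close>. The rows \<open>i+1, \<dots>, k\<close> of \<open>X\<close> vanish, so \<open>H\<close> just carries row \<open>i\<close> down to
  row \<open>k\<close> and \<open>H(X) = Q\<close>. It remains to see that \<open>E(F(R)) = X\<close>.

  Let \<open>Y\<^sub>l\<close> be the array reached from \<open>R\<close> after the factors \<open>f\<^sub>i, \<dots>, f\<^sub>l\<close> of \<open>F\<close>, and \<open>Z\<^sub>l\<close> the array from
  which the factors \<open>e\<^sub>l, \<dots>, e\<^sub>i\<close> of \<open>E\<close> lead to \<open>X\<close>. The two differ in row \<open>i\<close> only: the entries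
  \<open>q\<^sub>1, \<dots>, q\<^bsub>l-1\<^esub>\<close> of \<open>Z\<^sub>l\<close> are \<open>0\<close> in \<open>Y\<^sub>l\<close>, and \<open>Y\<^sub>l\<close> has the excess \<open>q\<^sub>1 + \<dots> + q\<^bsub>l-1\<^esub>\<close> in column \<open>l\<close>.
  Passing from \<open>l+1\<close> to \<open>l\<close>, the Dyck path inequalities for paths running along row \<open>k\<close> of \<open>Q\<close> force
  the first \<open>q\<^sub>1 + \<dots> + q\<^sub>l\<close> applications of \<open>f\<^sub>l\<close> to \<open>Y\<^bsub>l+1\<^esub>\<close> to act in row \<open>i\<close>, where they cancel the
  excess in column \<open>l+1\<close>. After that, \<open>f\<^sub>l\<close> acts in the same way on both arrays, because the entry in
  row \<open>i\<close> of column \<open>l\<close> shifts all values of \<open>U\<close> equally; on the side of \<open>Z\<close> these steps are undone by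
  \<open>e\<^sub>l\<close>. At \<open>l = t\<close> only the first phase, of length \<open>q\<^sub>t\<close>, takes place, and it ends in \<open>Z\<^bsub>t+1\<^esub>\<close>
  (in \<open>X\<close> if \<open>t = i\<close>).
\<close>

section \<open>Partial maps and maximizers\<close>

text \<open>Signed quantities below are differences of casts of sums in \<open>nat\<close>; keeping
  \<open>int\<close> outside a sum lets facts about natural sums rewrite inside it.\<close>

declare of_nat_sum [simp del]

lemma partial_pow_0 [simp]: "partial_pow g 0 = Some"
  by (simp add: partial_pow_def)

lemma partial_pow_Suc: "partial_pow g (Suc c) A = Option.bind (partial_pow g c A) g"
  by (simp add: partial_pow_def map_comp_def split: option.split)

lemma partial_pow_add:
  "partial_pow g (c + d) A = Option.bind (partial_pow g c A) (partial_pow g d)"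
proof (induction d)
  case 0
  then show ?case by (cases "partial_pow g c A") auto
next
  case (Suc d)
  then show ?case by (cases "partial_pow g c A") (simp_all add: partial_pow_Suc)
qed

lemma partial_comp_Nil [simp]: "partial_comp [] = Some"
  by (simp add: partial_comp_def)

lemma partial_comp_Cons: "partial_comp (g # gs) A = Option.bind (partial_comp gs A) g"
  by (simp add: partial_comp_def map_comp_def split: option.split)

lemma partial_comp_snoc: "partial_comp (gs @ [g]) A = Option.bind (g A) (partial_comp gs)"
proof (induction gs)
  case Nil
  then show ?case by (cases "g A") (simp_all add: partial_comp_Cons)
next
  case (Cons h gs)
  then show ?case by (cases "g A") (simp_all add: partial_comp_Cons)
qed

lemma sum_update_incr:
  fixes f :: "nat \<Rightarrow> nat"
  assumes "finite S"
  shows "sum (f(p := f p + c)) S = sum f S + (if p \<in> S then c else 0)"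
  using assms by (auto simp: sum.remove[of S p] intro: sum.cong)

lemma sum_update_decr:
  fixes f :: "nat \<Rightarrow> nat"
  assumes "finite S" and "c \<le> f p"
  shows "sum (f(p := f p - c)) S + (if p \<in> S then c else 0) = sum f S"
  using assms by (auto simp: sum.remove[of S p] intro: sum.cong)

lemma is_arg_max_exists:
  fixes f :: "nat \<Rightarrow> nat"
  assumes "a \<le> b"
  shows "\<exists>p. is_arg_max f (\<lambda>p. p \<in> {a..b}) p"
proof -
  have "Max (f ` {a..b}) \<in> f ` {a..b}"
    using assms by (intro Max_in) auto
  then obtain p where "p \<in> {a..b}" "f p = Max (f ` {a..b})"
    by auto
  then have "is_arg_max f (\<lambda>p. p \<in> {a..b}) p"
    by (auto simp: is_arg_max_def not_less)
  then show ?thesis ..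
qed

lemma Greatest_arg_max:
  fixes f :: "nat \<Rightarrow> nat"
  assumes "a \<le> b"
  defines "p \<equiv> (GREATEST p. is_arg_max f (\<lambda>p. p \<in> {a..b}) p)"
  shows "p \<in> {a..b}" and "\<And>r. r \<in> {a..b} \<Longrightarrow> f r \<le> f p" and "\<And>r. r \<in> {p<..b} \<Longrightarrow> f r < f p"
proof -
  obtain p0 where "is_arg_max f (\<lambda>p. p \<in> {a..b}) p0"
    using is_arg_max_exists[OF assms(1)] by blast
  then have p: "is_arg_max f (\<lambda>p. p \<in> {a..b}) p"
    unfolding p_def by (rule GreatestI_nat[where b = b]) (auto simp: is_arg_max_def)
  then show mem: "p \<in> {a..b}" and le: "\<And>r. r \<in> {a..b} \<Longrightarrow> f r \<le> f p"
    by (auto simp: is_arg_max_def not_less)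
  have "r \<le> p" if "is_arg_max f (\<lambda>p. p \<in> {a..b}) r" for r
    unfolding p_def using that by (rule Greatest_le_nat[where b = b]) (auto simp: is_arg_max_def)
  then have "\<not> is_arg_max f (\<lambda>p. p \<in> {a..b}) r" if "r \<in> {p<..b}" for r
    using that by force
  moreover have "is_arg_max f (\<lambda>p. p \<in> {a..b}) r" if "r \<in> {a..b}" "f r = f p" for r
    using that p by (simp add: is_arg_max_def)
  ultimately have "f r \<noteq> f p" if "r \<in> {p<..b}" for r
    using that mem by force
  then show "f r < f p" if "r \<in> {p<..b}" for r
    using that mem le[of r] by (simp add: le_neq_implies_less)
qed

lemma Least_arg_max:
  fixes f :: "nat \<Rightarrow> nat"
  assumes "a \<le> b"
  defines "p \<equiv> (LEAST p. is_arg_max f (\<lambda>p. p \<in> {a..b}) p)"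
  shows "p \<in> {a..b}" and "\<And>r. r \<in> {a..b} \<Longrightarrow> f r \<le> f p" and "\<And>r. r \<in> {a..<p} \<Longrightarrow> f r < f p"
proof -
  obtain p0 where "is_arg_max f (\<lambda>p. p \<in> {a..b}) p0"
    using is_arg_max_exists[OF assms(1)] by blast
  then have p: "is_arg_max f (\<lambda>p. p \<in> {a..b}) p"
    unfolding p_def by (rule LeastI)
  then show mem: "p \<in> {a..b}" and le: "\<And>r. r \<in> {a..b} \<Longrightarrow> f r \<le> f p"
    by (auto simp: is_arg_max_def not_less)
  have "p \<le> r" if "is_arg_max f (\<lambda>p. p \<in> {a..b}) r" for r
    unfolding p_def using that by (rule Least_le)
  then have "\<not> is_arg_max f (\<lambda>p. p \<in> {a..b}) r" if "r \<in> {a..<p}" for r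
    using that by force
  moreover have "is_arg_max f (\<lambda>p. p \<in> {a..b}) r" if "r \<in> {a..b}" "f r = f p" for r
    using that p by (simp add: is_arg_max_def)
  ultimately have "f r \<noteq> f p" if "r \<in> {a..<p}" for r
    using that mem by force
  then show "f r < f p" if "r \<in> {a..<p}" for r
    using that mem le[of r] by (simp add: le_neq_implies_less)
qed

section \<open>Operators on two adjacent columns\<close>

lemma p_minus_props:
  assumes "i \<le> n"
  shows "p_minus n i l A \<in> {i..n}"
    and "r \<in> {i..n} \<Longrightarrow> U_sum n i l A r \<le> U_sum n i l A (p_minus n i l A)"
    and "r \<in> {p_minus n i l A<..n} \<Longrightarrow> U_sum n i l A r < U_sum n i l A (p_minus n i l A)"
  using Greatest_arg_max[OF assms, where f = "U_sum n i l A"] by (auto simp: p_minus_def)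

lemma q_minus_props:
  assumes "i \<le> n"
  shows "q_minus n i l A \<in> {i..n}"
    and "r \<in> {i..n} \<Longrightarrow> U_sum n i l A r \<le> U_sum n i l A (q_minus n i l A)"
    and "r \<in> {i..<q_minus n i l A} \<Longrightarrow> U_sum n i l A r < U_sum n i l A (q_minus n i l A)"
  using Least_arg_max[OF assms, where f = "U_sum n i l A"] by (auto simp: q_minus_def)

lemma p_minus_eqI:
  assumes "p \<in> {i..n}" and "\<And>r. r \<in> {i..n} \<Longrightarrow> U_sum n i l A r \<le> U_sum n i l A p"
    and "\<And>r. r \<in> {p<..n} \<Longrightarrow> U_sum n i l A r < U_sum n i l A p"
  shows "p_minus n i l A = p"
proof -
  have "i \<le> n" using assms(1) by simp
  note pm = p_minus_props[OF this, where l = l and A = A]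
  show ?thesis
    using pm(1) pm(2)[OF assms(1)] pm(3)[of p] assms(1) assms(2)[OF pm(1)]
      assms(3)[of "p_minus n i l A"]
    by (metis atLeastAtMost_iff greaterThanAtMost_iff leD linorder_neqE_nat)
qed

lemma q_minus_eqI:
  assumes "p \<in> {i..n}" and "\<And>r. r \<in> {i..n} \<Longrightarrow> U_sum n i l A r \<le> U_sum n i l A p"
    and "\<And>r. r \<in> {i..<p} \<Longrightarrow> U_sum n i l A r < U_sum n i l A p"
  shows "q_minus n i l A = p"
proof -
  have "i \<le> n" using assms(1) by simp
  note pm = q_minus_props[OF this, where l = l and A = A]
  show ?thesis
    using pm(1) pm(2)[OF assms(1)] pm(3)[of p] assms(1) assms(2)[OF pm(1)]
      assms(3)[of "q_minus n i l A"]
    by (metis atLeastAtMost_iff atLeastLessThan_iff leD linorder_neqE_nat)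
qed

lemma sum_split_less:
  fixes f :: "nat \<Rightarrow> nat"
  assumes "p \<in> {a..b}"
  shows "sum f {a..b} = sum f {a..<p} + sum f {p..b}"
proof -
  have "{a..b} = {a..<p} \<union> {p..b}" using assms by auto
  then show ?thesis by (simp add: sum.union_disjoint ivl_disj_int)
qed

lemma sum_split_greater:
  fixes f :: "nat \<Rightarrow> nat"
  assumes "p \<in> {a..b}"
  shows "sum f {a..b} = sum f {a..p} + sum f {p<..b}"
proof -
  have "{a..b} = {a..p} \<union> {p<..b}" using assms by auto
  then show ?thesis by (simp add: sum.union_disjoint ivl_disj_int)
qed

text \<open>Adding the part of column \<open>l\<close> up to \<open>p_minus\<close> to both terms
  completes them to the maximum of \<open>U\<close> and a column total. Only the value of the
  maximum is then involved, not its position; \<open>crystal_eps_col\<close> is the analogue for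
  \<open>e\<close>.\<close>

lemma crystal_phi_col:
  assumes "l < i" "i \<le> n"
  shows "crystal_phi n i m l A
    = int (U_sum n i l A (p_minus n i l A)) - int (\<Sum>j=i..n. A l j)"
  using assms sum_split_greater[OF p_minus_props(1)[OF assms(2), where l = l and A = A], where f = "A l"]
  by (simp add: crystal_phi_def U_sum_def)

lemma crystal_eps_col:
  assumes "l < i" "i \<le> n"
  shows "crystal_eps n i l A
    = int (U_sum n i l A (q_minus n i l A)) - int (\<Sum>j=i..n. A (l + 1) j)"
  using assms sum_split_less[OF q_minus_props(1)[OF assms(2), where l = l and A = A], where f = "A (l + 1)"]
  by (simp add: crystal_eps_def U_sum_def)

lemma crystal_phi_nonneg:
  assumes "l < i" "i \<le> n"
  shows "crystal_phi n i m l A \<ge> 0"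
proof -
  have "(\<Sum>j=i..n. A l j) \<le> U_sum n i l A n"
    by (simp add: U_sum_def)
  also have "\<dots> \<le> U_sum n i l A (p_minus n i l A)"
    using p_minus_props(2)[OF assms(2), of n] assms(2) by simp
  finally show ?thesis
    by (simp add: crystal_phi_col[OF assms])
qed

abbreviation shift_left :: "nat \<Rightarrow> nat \<Rightarrow> array \<Rightarrow> array" where
  "shift_left l p A \<equiv> incr l p (decr (l + 1) p A)"

text \<open>Moving a unit in row \<open>p\<close> fixes \<open>U\<close> at \<open>p\<close>, raises
  it by one after \<open>p\<close> and lowers it by one before \<open>p\<close>. An indicator on
  each side avoids truncated subtraction.\<close>

lemma U_sum_incr_decr:
  assumes "A (l + 1) p > 0" "p \<in> {i..n}" "r \<in> {i..n}"
  shows "U_sum n i l (shift_left l p A) r + (if r \<le> p then 1 else 0)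
    = U_sum n i l A r + (if p \<le> r then 1 else 0)"
proof -
  have "sum (shift_left l p A l) {i..r} = sum (A l) {i..r} + (if p \<in> {i..r} then 1 else 0)"
    using sum_update_incr[of "{i..r}" "A l" p 1] by (simp add: incr_def decr_def)
  moreover have "sum (shift_left l p A (l + 1)) {r..n} + (if p \<in> {r..n} then 1 else 0)
      = sum (A (l + 1)) {r..n}"
    using sum_update_decr[of "{r..n}" 1 "A (l + 1)" p] assms(1) by (simp add: incr_def decr_def)
  ultimately show ?thesis
    using assms(2,3) by (auto simp: U_sum_def split: if_splits)
qed

text \<open>As \<open>p_minus\<close> is the largest maximizer, \<open>U\<close> drops strictly at
  the next row, which forces a positive entry in column \<open>l + 1\<close>. In the last row,
  \<open>phi\<close> itself is that entry.\<close>

lemma crystal_f_col: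
  assumes "l < i" "i \<le> n" "crystal_f n i m l A = Some B"
  shows "A (l + 1) (p_minus n i l A) > 0" and "B = shift_left l (p_minus n i l A) A"
proof -
  let ?p = "p_minus n i l A"
  note pm = p_minus_props[OF assms(2), where l = l and A = A]
  have phi: "crystal_phi n i m l A \<noteq> 0" and B: "B = shift_left l ?p A"
    using assms by (auto simp: crystal_f_def Let_def split: if_splits)
  show "B = shift_left l ?p A" by (fact B)
  show "A (l + 1) ?p > 0"
  proof (cases "?p = n")
    case True
    then show ?thesis
      using phi by (simp add: crystal_phi_col[OF assms(1,2)] U_sum_def)
  next
    case False
    with pm(1) have lt: "Suc ?p \<in> {?p<..n}" by auto
    have "(\<Sum>j=?p..n. A (l + 1) j) = A (l + 1) ?p + (\<Sum>j=Suc ?p..n. A (l + 1) j)"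
      using pm(1) by (simp add: sum.atLeast_Suc_atMost)
    then show ?thesis
      using pm(3)[OF lt] pm(1) by (simp add: U_sum_def)
  qed
qed

text \<open>Values after \<open>p\<close> were strictly below the maximum and rise by one only;
  values before \<open>p\<close> fall. So the maximum is unchanged and \<open>p\<close> turns from
  the largest into the smallest maximizer.\<close>

lemma U_max_crystal_f:
  assumes "l < i" "i \<le> n" "crystal_f n i m l A = Some B"
  defines "p \<equiv> p_minus n i l A"
  shows "U_sum n i l B p = U_sum n i l A p"
    and "r \<in> {i..n} \<Longrightarrow> U_sum n i l B r \<le> U_sum n i l A p"
    and "r \<in> {i..<p} \<Longrightarrow> U_sum n i l B r < U_sum n i l A p"
proof -
  note pm = p_minus_props[OF assms(2), where l = l and A = A, folded p_def]
  note f = crystal_f_col[OF assms(1-3), folded p_def]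
  note U = U_sum_incr_decr[where l = l and A = A and p = p and i = i and n = n, OF f(1) pm(1), folded f(2)]
  show "U_sum n i l B p = U_sum n i l A p"
    using U[OF pm(1)] by simp
  show "U_sum n i l B r \<le> U_sum n i l A p" if "r \<in> {i..n}"
    using U[OF that] pm(2)[OF that] pm(3)[of r] that by (auto split: if_splits)
  show "U_sum n i l B r < U_sum n i l A p" if "r \<in> {i..<p}"
    using U[of r] pm(1) pm(2)[of r] that by (auto split: if_splits)
qed

lemma sum_crystal_f_left:
  assumes "l < i" "i \<le> n" "crystal_f n i m l A = Some B"
  shows "(\<Sum>j=i..n. B l j) = (\<Sum>j=i..n. A l j) + 1"
  using sum_update_incr[of "{i..n}" "A l" "p_minus n i l A" 1]
    p_minus_props(1)[OF assms(2), of l A] crystal_f_col[OF assms]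
  by (simp add: incr_def decr_def)

lemma sum_crystal_f_right:
  assumes "l < i" "i \<le> n" "crystal_f n i m l A = Some B"
  shows "(\<Sum>j=i..n. B (l + 1) j) + 1 = (\<Sum>j=i..n. A (l + 1) j)"
  using sum_update_decr[of "{i..n}" 1 "A (l + 1)" "p_minus n i l A"]
    p_minus_props(1)[OF assms(2), of l A] crystal_f_col[OF assms]
  by (simp add: incr_def decr_def)

lemma crystal_phi_crystal_f:
  assumes "l < i" "i \<le> n" "crystal_f n i m l A = Some B"
  shows "crystal_phi n i m l B = crystal_phi n i m l A - 1"
proof -
  have "U_sum n i l B (p_minus n i l B) = U_sum n i l A (p_minus n i l A)"
    using U_max_crystal_f(2)[OF assms p_minus_props(1)[OF assms(2)], of l B]
      U_max_crystal_f(1)[OF assms] p_minus_props(1,2)[OF assms(2)]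
    by (metis antisym)
  then show ?thesis
    using sum_crystal_f_left[OF assms] by (simp add: crystal_phi_col[OF assms(1,2)])
qed

text \<open>The row in which \<open>e\<close> will act on \<open>B\<close> is the one in which
  \<open>f\<close> has just acted; this is why \<open>e\<close> undoes \<open>f\<close>.\<close>

lemma q_minus_crystal_f:
  assumes "l < i" "i \<le> n" "crystal_f n i m l A = Some B"
  shows "q_minus n i l B = p_minus n i l A"
  using U_max_crystal_f[OF assms] p_minus_props(1)[OF assms(2), of l A]
  by (intro q_minus_eqI) auto

lemma crystal_eps_crystal_f:
  assumes "l < i" "i \<le> n" "crystal_f n i m l A = Some B"
  shows "crystal_eps n i l B = crystal_eps n i l A + 1"
proof -
  have "U_sum n i l A (q_minus n i l A) = U_sum n i l A (p_minus n i l A)"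
    using p_minus_props(1,2)[OF assms(2)] q_minus_props(1,2)[OF assms(2)] by (metis antisym)
  then show ?thesis
    using sum_crystal_f_right[OF assms] U_max_crystal_f(1)[OF assms]
    by (simp add: crystal_eps_col[OF assms(1,2)] q_minus_crystal_f[OF assms])
qed

lemma crystal_eps_nonneg:
  assumes "l < i" "i \<le> n"
  shows "crystal_eps n i l A \<ge> 0"
proof -
  have "(\<Sum>j=i..n. A (l + 1) j) \<le> U_sum n i l A i"
    by (simp add: U_sum_def)
  also have "\<dots> \<le> U_sum n i l A (q_minus n i l A)"
    using q_minus_props(2)[OF assms(2), of i] assms(2) by simp
  finally show ?thesis
    by (simp add: crystal_eps_col[OF assms])
qed

lemma crystal_e_crystal_f:
  assumes "l < i" "i \<le> n" "crystal_f n i m l A = Some B"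
  shows "crystal_e n i l B = Some A"
proof -
  let ?p = "p_minus n i l A"
  note f = crystal_f_col[OF assms]
  have "crystal_eps n i l B \<noteq> 0"
    using crystal_eps_crystal_f[OF assms] crystal_eps_nonneg[OF assms(1,2), of A] by simp
  then have "crystal_e n i l B = Some (incr (l + 1) ?p (decr l ?p B))"
    using assms(1) by (simp add: crystal_e_def q_minus_crystal_f[OF assms] Let_def)
  also have "incr (l + 1) ?p (decr l ?p B) = A"
    using f(1) unfolding f(2) by (auto simp: incr_def decr_def fun_eq_iff)
  finally show ?thesis .
qed

text \<open>With \<open>r = n\<close> in the conclusion, this bounds a final segment of column \<open>l\<close> of \<open>B\<close> by the weight
  of a path through columns \<open>l\<close> and \<open>l + 1\<close> of \<open>A\<close>.\<close>

lemma tail_bound_crystal_f: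
  assumes "l < i" "i \<le> n" "crystal_f n i m l A = Some B" and "a \<in> {i..n}"
    and bound: "\<And>r. r \<in> {a..n} \<Longrightarrow> (\<Sum>j=a..r. A l j) + (\<Sum>j=r..n. A (l + 1) j) \<le> w"
    and r: "r \<in> {a..n}"
  shows "(\<Sum>j=a..r. B l j) + (\<Sum>j=r..n. B (l + 1) j) \<le> w"
proof -
  let ?p = "p_minus n i l A"
  note f = crystal_f_col[OF assms(1-3)]
  note pm = p_minus_props(1)[OF assms(2), of l A]
  have split: "sum g {i..s} = sum g {i..<a} + sum g {a..s}" if "s \<in> {a..n}" for s and g :: "nat \<Rightarrow> nat"
    using that assms(4) by (intro sum_split_less) auto
  show ?thesis
  proof (cases "?p < a")
    case True
    have "(\<Sum>j=a..r. B l j) = (\<Sum>j=a..r. A l j)" "(\<Sum>j=r..n. B (l + 1) j) = (\<Sum>j=r..n. A (l + 1) j)"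
      using True r unfolding f(2) by (auto simp: incr_def decr_def intro!: sum.cong)
    then show ?thesis using bound[OF r] by simp
  next
    case False
    then have pa: "?p \<in> {a..n}" using pm by auto
    \<comment> \<open>Adding the unchanged entries of column \<open>l\<close> before row
      \<open>a\<close> to both sides turns them into values of \<open>U\<close>, and
      \<open>U\<close> for \<open>B\<close> stays below the maximum for \<open>A\<close>.\<close>
    have "sum (B l) {i..<a} = sum (A l) {i..<a}"
      using False unfolding f(2) by (auto simp: incr_def decr_def intro!: sum.cong)
    then have "(\<Sum>j=a..r. B l j) + (\<Sum>j=r..n. B (l + 1) j) + sum (A l) {i..<a} = U_sum n i l B r"
      using split[OF r, of "B l"] by (simp add: U_sum_def)
    also have "\<dots> \<le> U_sum n i l A ?p"
      using r assms(4) by (intro U_max_crystal_f(2)[OF assms(1-3)]) auto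
    also have "\<dots> = (\<Sum>j=a..?p. A l j) + (\<Sum>j=?p..n. A (l + 1) j) + sum (A l) {i..<a}"
      using split[OF pa, of "A l"] by (simp add: U_sum_def)
    finally show ?thesis
      using bound[OF pa] by linarith
  qed
qed

lemma crystal_f_preserves:
  assumes "l < i" "i \<le> n" "crystal_f n i m l A = Some B"
  shows "B l q + B (l + 1) q = A l q + A (l + 1) q"
    and "p \<noteq> l \<Longrightarrow> p \<noteq> l + 1 \<Longrightarrow> B p = A p"
  using crystal_f_col[OF assms] by (auto simp: incr_def decr_def)

lemma partial_pow_SucE:
  assumes "partial_pow g (Suc c) A = Some B"
  obtains C where "partial_pow g c A = Some C" "g C = Some B"
  using assms by (auto simp: partial_pow_Suc bind_eq_Some_conv)

section \<open>Powers of \<open>f\<close> and \<open>e\<close> on columns \<open>l\<close> and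
  \<open>l + 1\<close>\<close>

context
  fixes n i m l :: nat
  assumes l: "l < i" and i: "i \<le> n"
begin

lemma crystal_phi_crystal_f_pow:
  assumes "partial_pow (crystal_f n i m l) c A = Some B"
  shows "crystal_phi n i m l B = crystal_phi n i m l A - int c"
  using assms
  by (induction c arbitrary: B) (auto elim!: partial_pow_SucE dest!: crystal_phi_crystal_f[OF l i])

lemma crystal_f_pow_defined:
  assumes "int c \<le> crystal_phi n i m l A"
  shows "\<exists>B. partial_pow (crystal_f n i m l) c A = Some B"
  using assms
proof (induction c)
  case (Suc c)
  then obtain B where B: "partial_pow (crystal_f n i m l) c A = Some B"
    by auto
  then have "crystal_phi n i m l B \<noteq> 0"
    using Suc.prems by (simp add: crystal_phi_crystal_f_pow)
  then obtain C where C: "crystal_f n i m l B = Some C"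
    using l by (auto simp: crystal_f_def Let_def)
  then show ?case
    using B by (auto simp: partial_pow_Suc)
qed simp

lemma crystal_eps_crystal_f_pow:
  assumes "partial_pow (crystal_f n i m l) c A = Some B"
  shows "crystal_eps n i l B = crystal_eps n i l A + int c"
  using assms
  by (induction c arbitrary: B) (auto elim!: partial_pow_SucE dest!: crystal_eps_crystal_f[OF l i])

lemma crystal_e_pow_crystal_f_pow:
  assumes "partial_pow (crystal_f n i m l) c A = Some B"
  shows "partial_pow (crystal_e n i l) c B = Some A"
  using assms
proof (induction c arbitrary: B)
  case (Suc c)
  then obtain C where C: "partial_pow (crystal_f n i m l) c A = Some C" "crystal_f n i m l C = Some B"
    by (auto elim: partial_pow_SucE)
  \<comment> \<open>Writing \<open>1 + c\<close> splits off the first application, whereas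
    \<open>partial_pow_Suc\<close> splits off the last.\<close>
  have "partial_pow (crystal_e n i l) (1 + c) B = Some A"
    using crystal_e_crystal_f[OF l i C(2)] Suc.IH[OF C(1)]
    by (simp only: partial_pow_add) (simp add: partial_pow_Suc)
  then show ?case by simp
qed simp

lemma sum_crystal_f_pow:
  assumes "partial_pow (crystal_f n i m l) c A = Some B"
  shows "(\<Sum>j=i..n. B l j) = (\<Sum>j=i..n. A l j) + c"
  using assms
  by (induction c arbitrary: B) (auto elim!: partial_pow_SucE dest!: sum_crystal_f_left[OF l i])

lemma crystal_f_pow_preserves:
  assumes "partial_pow (crystal_f n i m l) c A = Some B"
  shows "B l q + B (l + 1) q = A l q + A (l + 1) q"
    and "p \<noteq> l \<Longrightarrow> p \<noteq> l + 1 \<Longrightarrow> B p = A p"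
proof -
  show "B l q + B (l + 1) q = A l q + A (l + 1) q"
    using assms by (induction c arbitrary: B)
      (auto elim!: partial_pow_SucE dest: crystal_f_preserves(1)[OF l i, of _ _ _ q])
  show "B p = A p" if "p \<noteq> l" "p \<noteq> l + 1"
    using assms by (induction c arbitrary: B)
      (auto elim!: partial_pow_SucE dest: crystal_f_preserves(2)[OF l i _ that])
qed

lemma tail_bound_crystal_f_pow:
  assumes "partial_pow (crystal_f n i m l) c A = Some B" and a: "a \<in> {i..n}"
    and "\<And>r. r \<in> {a..n} \<Longrightarrow> (\<Sum>j=a..r. A l j) + (\<Sum>j=r..n. A (l + 1) j) \<le> w"
    and "r \<in> {a..n}"
  shows "(\<Sum>j=a..r. B l j) + (\<Sum>j=r..n. B (l + 1) j) \<le> w"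
  using assms(1,4)
proof (induction c arbitrary: B r)
  case 0
  then show ?case using assms(3) by simp
next
  case (Suc c)
  then obtain C where C: "partial_pow (crystal_f n i m l) c A = Some C" "crystal_f n i m l C = Some B"
    by (auto elim: partial_pow_SucE)
  show ?case
    by (rule tail_bound_crystal_f[OF l i C(2) a Suc.IH[OF C(1)] Suc.prems(2)])
qed

text \<open>Row \<open>i\<close> leads all later rows in \<open>U\<close> by at least
  \<open>s\<close>, and each application there shortens the lead by one. Before each of the
  \<open>s\<close> applications row \<open>i\<close> is thus still the only maximizer.\<close>

lemma crystal_f_pow_first_row:
  assumes "\<And>p. p \<in> {i<..n} \<Longrightarrow> U_sum n i l A p + s \<le> U_sum n i l A i" and "s \<le> A (l + 1) i"
  shows "partial_pow (crystal_f n i m l) s A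
    = Some (A(l := (A l)(i := A l i + s), l + 1 := (A (l + 1))(i := A (l + 1) i - s)))"
  using assms
proof (induction s)
  case (Suc s)
  define B where "B = A(l := (A l)(i := A l i + s), l + 1 := (A (l + 1))(i := A (l + 1) i - s))"
  have IH: "partial_pow (crystal_f n i m l) s A = Some B"
    unfolding B_def using Suc.prems by (intro Suc.IH) force+
  have U: "U_sum n i l B p + (if p = i then s else 0) = U_sum n i l A p + s" if p: "p \<in> {i..n}" for p
  proof -
    have "sum (B l) {i..p} = sum (A l) {i..p} + s"
      using sum_update_incr[of "{i..p}" "A l" i s] p by (simp add: B_def)
    moreover have "sum (B (l + 1)) {p..n} + (if p = i then s else 0) = sum (A (l + 1)) {p..n}"
      using sum_update_decr[of "{p..n}" s "A (l + 1)" i] p Suc.prems(2)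
      by (auto simp: B_def)
    ultimately show ?thesis by (simp add: U_sum_def)
  qed
  have less: "U_sum n i l B p < U_sum n i l B i" if "p \<in> {i<..n}" for p
    using U[of p] U[of i] Suc.prems(1)[OF that] that by auto
  have pm: "p_minus n i l B = i"
    using less i by (intro p_minus_eqI) (force simp: le_less)+
  have "(\<Sum>j=i..n. B l j) < U_sum n i l B i"
  proof (cases "i = n")
    case True
    then show ?thesis using Suc.prems(2) by (simp add: B_def U_sum_def)
  next
    case False
    have "(\<Sum>j=i..n. B l j) \<le> U_sum n i l B n" by (simp add: U_sum_def)
    also have "\<dots> < U_sum n i l B i" using less[of n] False i by simp
    finally show ?thesis .
  qed
  then have "crystal_phi n i m l B \<noteq> 0"
    by (simp add: crystal_phi_col[OF l i] pm)
  then have "crystal_f n i m l B = Some (shift_left l i B)"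
    using l by (simp add: crystal_f_def pm Let_def)
  moreover have "shift_left l i B
      = A(l := (A l)(i := A l i + Suc s), l + 1 := (A (l + 1))(i := A (l + 1) i - Suc s))"
    by (intro ext) (auto simp: B_def incr_def decr_def)
  ultimately show ?case
    by (simp only: partial_pow_Suc IH Option.bind.simps)
qed (simp add: fun_eq_iff)

end

text \<open>In the application \<open>s\<close> is the sum of the entries cleared in row
  \<open>i\<close>, so they are gathered in column \<open>l\<close>.\<close>

definition relift :: "nat \<Rightarrow> nat \<Rightarrow> nat \<Rightarrow> array \<Rightarrow> array" where
  "relift i l s A = (\<lambda>p q. if q = i \<and> p < l then 0 else if q = i \<and> p = l then A p q + s else A p q)"

text \<open>Row \<open>i\<close> is the first row, so \<open>s\<close> enters every initial sum of
  column \<open>l\<close> as well as its total; maximizers and \<open>phi\<close> do not change. The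
  cleared entries lie in columns that \<open>f\<close> does not read.\<close>

lemma crystal_f_relift:
  assumes "l < i" "i \<le> n"
  shows "crystal_f n i m l (relift i l s A) = map_option (relift i l s) (crystal_f n i m l A)"
proof -
  have left: "relift i l s A l = (A l)(i := A l i + s)"
    and right: "relift i l s A (l + 1) = A (l + 1)"
    by (auto simp: relift_def)
  have U: "U_sum n i l (relift i l s A) r = U_sum n i l A r + s" if "r \<in> {i..n}" for r
    using that sum_update_incr[of "{i..r}" "A l" i s] unfolding U_sum_def left right by simp
  then have "is_arg_max (U_sum n i l (relift i l s A)) (\<lambda>p. p \<in> {i..n})
      = is_arg_max (U_sum n i l A) (\<lambda>p. p \<in> {i..n})"
    unfolding is_arg_max_def fun_eq_iff by (metis add_less_cancel_right)
  then have pm: "p_minus n i l (relift i l s A) = p_minus n i l A"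
    by (simp add: p_minus_def)
  have "crystal_phi n i m l (relift i l s A) = crystal_phi n i m l A"
    using U[OF p_minus_props(1)[OF assms(2), of l A]] sum_update_incr[of "{i..n}" "A l" i s] assms(2)
    unfolding crystal_phi_col[OF assms] pm left by simp
  moreover have "shift_left l p (relift i l s A) = relift i l s (shift_left l p A)" for p
    by (auto simp: fun_eq_iff relift_def incr_def decr_def)
  ultimately show ?thesis
    using assms(1) by (simp add: crystal_f_def pm Let_def)
qed

lemma crystal_f_pow_relift:
  assumes "l < i" "i \<le> n"
  shows "partial_pow (crystal_f n i m l) c (relift i l s A)
    = map_option (relift i l s) (partial_pow (crystal_f n i m l) c A)"
proof (induction c)
  case (Suc c)
  then show ?case
    by (cases "partial_pow (crystal_f n i m l) c A")
      (simp_all add: partial_pow_Suc crystal_f_relift[OF assms])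
qed simp

section \<open>Operators on two adjacent rows\<close>

lemma p_plus_props:
  assumes "1 \<le> i"
  shows "p_plus i l A \<in> {1..i}"
    and "r \<in> {1..i} \<Longrightarrow> T_sum i l A r \<le> T_sum i l A (p_plus i l A)"
    and "r \<in> {1..<p_plus i l A} \<Longrightarrow> T_sum i l A r < T_sum i l A (p_plus i l A)"
  using Least_arg_max[OF assms, where f = "T_sum i l A"] by (auto simp: p_plus_def)

lemma p_plus_eqI:
  assumes "p \<in> {1..i}" and "\<And>r. r \<in> {1..i} \<Longrightarrow> T_sum i l A r \<le> T_sum i l A p"
    and "\<And>r. r \<in> {1..<p} \<Longrightarrow> T_sum i l A r < T_sum i l A p"
  shows "p_plus i l A = p"
proof -
  have "1 \<le> i" using assms(1) by simp
  note pm = p_plus_props[OF this, where l = l and A = A]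
  show ?thesis
    using pm(1) pm(2)[OF assms(1)] pm(3)[of p] assms(1) assms(2)[OF pm(1)]
      assms(3)[of "p_plus i l A"]
    by (metis atLeastAtMost_iff atLeastLessThan_iff leD linorder_neqE_nat)
qed

text \<open>At \<open>p\<close> the sum \<open>T\<close> contains both rows entirely, its largest
  conceivable value; a smaller index misses the positive entry of row \<open>l - 1\<close> in column
  \<open>p\<close>.\<close>

lemma crystal_phi_row:
  assumes "i < l" and p: "p \<in> {1..i}" and "A p (l - 1) > 0"
    and "\<And>j. j \<in> {p<..i} \<Longrightarrow> A j (l - 1) = 0" and "\<And>j. j \<in> {1..<p} \<Longrightarrow> A j l = 0"
  shows "p_plus i l A = p" and "crystal_phi n i m l A = int (\<Sum>j=1..i. A j (l - 1))"
proof -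
  have left: "(\<Sum>j=1..i. A j (l - 1)) = (\<Sum>j=1..p. A j (l - 1))"
    using assms(4) sum_split_greater[OF p, of "\<lambda>j. A j (l - 1)"] by simp
  have right: "(\<Sum>j=1..i. A j l) = (\<Sum>j=p..i. A j l)"
    using assms(5) sum_split_less[OF p, of "\<lambda>j. A j l"] by simp
  have T: "T_sum i l A p = (\<Sum>j=1..i. A j (l - 1)) + (\<Sum>j=1..i. A j l)"
    by (simp only: T_sum_def left right)
  show p_plus: "p_plus i l A = p"
  proof (rule p_plus_eqI[OF p])
    show "T_sum i l A r \<le> T_sum i l A p" if "r \<in> {1..i}" for r
      unfolding T using that unfolding T_sum_def by (intro add_mono sum_mono2) auto
    show "T_sum i l A r < T_sum i l A p" if r: "r \<in> {1..<p}" for r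
    proof -
      have "(\<Sum>j=1..r. A j (l - 1)) + A p (l - 1) = (\<Sum>j\<in>insert p {1..r}. A j (l - 1))"
        using r by simp
      also have "\<dots> \<le> (\<Sum>j=1..i. A j (l - 1))"
        using r p by (intro sum_mono2) auto
      finally have "(\<Sum>j=1..r. A j (l - 1)) < (\<Sum>j=1..i. A j (l - 1))"
        using assms(3) by linarith
      moreover have "(\<Sum>j=r..i. A j l) \<le> (\<Sum>j=1..i. A j l)"
        using r by (intro sum_mono2) auto
      ultimately show ?thesis unfolding T by (simp add: T_sum_def)
    qed
  qed
  show "crystal_phi n i m l A = int (\<Sum>j=1..i. A j (l - 1))"
    using assms(1,5) unfolding left by (simp add: crystal_phi_def p_plus)
qed

text \<open>Row \<open>l - 1\<close> is emptied from its last nonzero column leftwards. The third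
  hypothesis is the invariant: row \<open>l\<close> is filled only weakly to the right of what
  remains in row \<open>l - 1\<close>.\<close>

lemma crystal_f_pow_row:
  assumes "i < l" and "\<And>p. p \<notin> {1..i} \<Longrightarrow> A p (l - 1) = 0"
    and "\<And>a b. A a l > 0 \<Longrightarrow> A b (l - 1) > 0 \<Longrightarrow> b \<le> a"
    and "c = (\<Sum>j=1..i. A j (l - 1))"
  shows "partial_pow (crystal_f n i m l) c A
    = Some (\<lambda>p q. if q = l then A p (l - 1) + A p l else if q = l - 1 then 0 else A p q)"
  using assms(2-)
proof (induction c arbitrary: A)
  case 0
  then have "A p (l - 1) = 0" for p
    by (cases "p \<in> {1..i}") auto
  then show ?case using assms(1) by (auto simp: fun_eq_iff)
next
  case (Suc c)
  define p where "p = Max {p \<in> {1..i}. A p (l - 1) > 0}"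
  have "{p \<in> {1..i}. A p (l - 1) > 0} \<noteq> {}"
  proof
    assume "{p \<in> {1..i}. A p (l - 1) > 0} = {}"
    then have "(\<Sum>j=1..i. A j (l - 1)) = 0" by auto
    then show False using Suc.prems(3) by simp
  qed
  then have "p \<in> {p \<in> {1..i}. A p (l - 1) > 0}"
    unfolding p_def by (intro Max_in) auto
  then have p: "p \<in> {1..i}" "A p (l - 1) > 0" by auto
  have p_max: "j \<le> p" if "A j (l - 1) > 0" for j
    unfolding p_def using that Suc.prems(1)[of j] by (intro Max_ge) auto
  have "A j (l - 1) = 0" if "j \<in> {p<..i}" for j
    using p_max[of j] that by force
  moreover have "A j l = 0" if "j \<in> {1..<p}" for j
    using Suc.prems(2)[of j p] p(2) that by force
  ultimately have pp: "p_plus i l A = p" "crystal_phi n i m l A = int (\<Sum>j=1..i. A j (l - 1))"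
    using crystal_phi_row[where A = A and l = l and i = i and p = p, OF assms(1) p] by auto
  define B where "B = incr p l (decr p (l - 1) A)"
  have B: "B a q = (if a = p \<and> q = l then A a q + 1 else if a = p \<and> q = l - 1 then A a q - 1 else A a q)"
    for a q
    using assms(1) by (auto simp: B_def incr_def decr_def)
  have "crystal_phi n i m l A \<noteq> 0"
    unfolding pp(2) Suc.prems(3)[symmetric] by simp
  then have f: "crystal_f n i m l A = Some B"
    using assms(1) pp(1) by (simp add: crystal_f_def B_def Let_def)
  have row: "(\<lambda>j. B j (l - 1)) = (\<lambda>j. A j (l - 1))(p := A p (l - 1) - 1)"
    using assms(1) by (intro ext) (auto simp: B)
  have "Suc c = (\<Sum>j=1..i. B j (l - 1)) + 1"
    unfolding row Suc.prems(3)
    using sum_update_decr[of "{1..i}" 1 "\<lambda>j. A j (l - 1)" p] p by (simp del: fun_upd_apply)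
  moreover have "B q (l - 1) = 0" if "q \<notin> {1..i}" for q
    using that Suc.prems(1)[of q] p(1) by (auto simp: B)
  moreover have "b \<le> a" if "B a l > 0" "B b (l - 1) > 0" for a b
    using that Suc.prems(2)[of a b] p_max[of b] assms(1) by (auto simp: B split: if_splits)
  ultimately have "partial_pow (crystal_f n i m l) c B
      = Some (\<lambda>p q. if q = l then B p (l - 1) + B p l else if q = l - 1 then 0 else B p q)"
    by (intro Suc.IH) auto
  also have "(\<lambda>p q. if q = l then B p (l - 1) + B p l else if q = l - 1 then 0 else B p q)
      = (\<lambda>p q. if q = l then A p (l - 1) + A p l else if q = l - 1 then 0 else A p q)"
    using assms(1) p(2) by (auto simp: B fun_eq_iff)
  finally have "partial_pow (crystal_f n i m l) (1 + c) A
      = Some (\<lambda>p q. if q = l then A p (l - 1) + A p l else if q = l - 1 then 0 else A p q)"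
    by (simp only: partial_pow_add) (simp add: partial_pow_Suc f)
  then show ?case by simp
qed

lemma f_phi_row:
  assumes "1 \<le> i" "i < l" and "\<And>p. p \<notin> {1..i} \<Longrightarrow> A p (l - 1) = 0" and "\<And>p. A p l = 0"
  shows "f_phi n i m l A
    = Some (\<lambda>p q. if q = l then A p (l - 1) else if q = l - 1 then 0 else A p q)"
proof -
  have "crystal_phi n i m l A = int (\<Sum>j=1..i. A j (l - 1))"
  proof (cases "\<exists>p\<in>{1..i}. A p (l - 1) > 0")
    case True
    define p where "p = Max {p \<in> {1..i}. A p (l - 1) > 0}"
    have "p \<in> {p \<in> {1..i}. A p (l - 1) > 0}"
      unfolding p_def using True by (intro Max_in) auto
    then have p: "p \<in> {1..i}" "A p (l - 1) > 0" by auto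
    have "A j (l - 1) = 0" if "j \<in> {p<..i}" for j
    proof (rule ccontr)
      assume "A j (l - 1) \<noteq> 0"
      then have "j \<le> p" unfolding p_def using that by (intro Max_ge) auto
      then show False using that by simp
    qed
    then show ?thesis
      using crystal_phi_row(2)[where A = A and l = l and i = i and p = p, OF assms(2) p] assms(4) by simp
  next
    case False
    moreover have "p_plus i l A \<in> {1..i}"
      using p_plus_props(1)[OF assms(1)] .
    ultimately show ?thesis
      using assms(2,4) by (simp add: crystal_phi_def)
  qed
  then show ?thesis
    using crystal_f_pow_row[where A = A and i = i and l = l and n = n and m = m, OF assms(2,3) _ refl] assms(4)
    by (simp add: f_phi_def cong: if_cong)
qed

lemma op_H_row:
  assumes "1 \<le> i" "i \<le> k" and "\<And>p. p \<notin> {1..i} \<Longrightarrow> A p i = 0"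
    and "\<And>p q. q \<in> {i<..k} \<Longrightarrow> A p q = 0"
  shows "op_H n i m k A = Some (\<lambda>p q. if q = k then A p i else if q = i then 0 else A p q)"
  using assms(2,4)
proof (induction k rule: dec_induct)
  case base
  then show ?case by (simp add: op_H_def fun_eq_iff)
next
  case (step k)
  define B where "B = (\<lambda>p q. if q = k then A p i else if q = i then 0 else A p q)"
  have "op_H n i m k A = Some B"
    unfolding B_def using step.prems by (intro step.IH) auto
  then have "op_H n i m (Suc k) A = f_phi n i m (Suc k) B"
    using step.hyps(1) by (simp add: op_H_def partial_comp_Cons)
  also have "\<dots> = Some (\<lambda>p q. if q = Suc k then B p (Suc k - 1) else if q = Suc k - 1 then 0 else B p q)"
    using step assms by (intro f_phi_row) (auto simp: B_def)
  also have "(\<lambda>p q. if q = Suc k then B p (Suc k - 1) else if q = Suc k - 1 then 0 else B p q)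
      = (\<lambda>p q. if q = Suc k then A p i else if q = i then 0 else A p q)"
    using step by (auto simp: B_def fun_eq_iff)
  finally show ?case .
qed

section \<open>Initial segments of Dyck paths\<close>

text \<open>The weight \<open>g\<close> does not include the entry at the end point \<open>(p, q)\<close>.\<close>

inductive dyck_prefix :: "nat \<Rightarrow> array \<Rightarrow> nat \<Rightarrow> nat \<Rightarrow> nat \<Rightarrow> bool" for i Q where
  start: "dyck_prefix i Q 1 i 0"
| row_step: "dyck_prefix i Q p q g \<Longrightarrow> dyck_prefix i Q p (Suc q) (g + Q p q)"
| col_step: "dyck_prefix i Q p q g \<Longrightarrow> dyck_prefix i Q (Suc p) q (g + Q p q)"

text \<open>A prefix in the format of \<open>dyck_path\<close>: positions count from 1, the end
  point has position \<open>N\<close>, and the weight stops just before it.\<close>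

definition lattice_walk :: "nat \<Rightarrow> array \<Rightarrow> nat \<Rightarrow> nat \<times> nat \<Rightarrow> nat \<Rightarrow> (nat \<Rightarrow> nat \<times> nat) \<Rightarrow> bool" where
  "lattice_walk i Q N e g \<beta> \<longleftrightarrow> \<beta> 1 = (1, i) \<and> \<beta> N = e \<and>
     (\<forall>r\<in>{1..<N}. \<beta> (r + 1) = (fst (\<beta> r), snd (\<beta> r) + 1) \<or>
                    \<beta> (r + 1) = (fst (\<beta> r) + 1, snd (\<beta> r))) \<and>
     (\<Sum>r\<in>{1..<N}. Q (fst (\<beta> r)) (snd (\<beta> r))) = g"

lemma lattice_walk_extend:
  assumes "lattice_walk i Q N (p, q) g \<beta>" "1 \<le> N" and "e = (p, q + 1) \<or> e = (p + 1, q)"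
  shows "lattice_walk i Q (Suc N) e (g + Q p q) (\<beta>(Suc N := e))"
proof -
  have "(\<Sum>r\<in>{1..<N}. Q (fst ((\<beta>(Suc N := e)) r)) (snd ((\<beta>(Suc N := e)) r))) = g"
    using assms(1) by (auto simp: lattice_walk_def intro!: sum.cong)
  then show ?thesis
    using assms by (auto simp: lattice_walk_def less_Suc_eq)
qed

text \<open>Each step raises \<open>p + q\<close> by one and \<open>(1, i)\<close> has position 1,
  so \<open>(p, q)\<close> has position \<open>p + q - i\<close>. The bounds on \<open>p\<close> and
  \<open>q\<close> keep this difference from being truncated.\<close>

lemma dyck_prefix_walk:
  assumes "dyck_prefix i Q p q g"
  shows "1 \<le> p \<and> i \<le> q \<and> (\<exists>\<beta>. lattice_walk i Q (p + q - i) (p, q) g \<beta>)"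
  using assms
proof induction
  case start
  then show ?case by (auto simp: lattice_walk_def)
next
  case (row_step p q g)
  then obtain \<beta> where "lattice_walk i Q (p + q - i) (p, q) g \<beta>" by blast
  moreover have "1 \<le> p + q - i" using row_step.IH by linarith
  ultimately
  have "lattice_walk i Q (p + Suc q - i) (p, Suc q) (g + Q p q) (\<beta>(Suc (p + q - i) := (p, Suc q)))"
    using lattice_walk_extend[where e = "(p, Suc q)"] row_step.IH by (simp add: Suc_diff_le)
  then show ?case using row_step.IH le_SucI by blast
next
  case (col_step p q g)
  then obtain \<beta> where "lattice_walk i Q (p + q - i) (p, q) g \<beta>" by blast
  moreover have "1 \<le> p + q - i" using col_step.IH by linarith
  ultimately
  have "lattice_walk i Q (Suc p + q - i) (Suc p, q) (g + Q p q) (\<beta>(Suc (p + q - i) := (Suc p, q)))"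
    using lattice_walk_extend[where e = "(Suc p, q)"] col_step.IH by (simp add: Suc_diff_le)
  then show ?case using col_step.IH le_SucI by blast
qed

lemma dyck_prefix_bound:
  assumes "Q \<in> crystal_B n i m" "1 \<le> i" "i \<le> n" "dyck_prefix i Q i n g"
  shows "g + Q i n \<le> m"
proof -
  obtain \<beta> where \<beta>: "lattice_walk i Q n (i, n) g \<beta>"
    using dyck_prefix_walk[OF assms(4)] by auto
  then have "dyck_path n i \<beta>"
    by (simp add: lattice_walk_def dyck_path_def)
  then have "(\<Sum>r=1..n. Q (fst (\<beta> r)) (snd (\<beta> r))) \<le> m"
    using assms(1) by (simp add: crystal_B_def)
  moreover have "{1..n} = insert n {1..<n}"
    using assms(2,3) by auto
  ultimately show ?thesis
    using \<beta> by (simp add: lattice_walk_def)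
qed

lemma dyck_prefix_rows:
  assumes "dyck_prefix i Q p q g" "q \<le> r"
  shows "dyck_prefix i Q p r (g + sum (Q p) {q..<r})"
  using assms(2)
proof (induction r rule: dec_induct)
  case (step r)
  from dyck_prefix.row_step[OF step.IH] step.hyps show ?case by (simp add: add.assoc)
qed (use assms(1) in simp)

lemma dyck_prefix_cols:
  assumes "dyck_prefix i Q p q g" "p \<le> r"
  shows "dyck_prefix i Q r q (g + (\<Sum>j=p..<r. Q j q))"
  using assms(2)
proof (induction r rule: dec_induct)
  case (step r)
  from dyck_prefix.col_step[OF step.IH] step.hyps show ?case by (simp add: add.assoc)
qed (use assms(1) in simp)

section \<open>The operators with index \<open>i\<close>\<close>

lemma crystal_f_pow_diag:
  assumes "i \<le> n" "int c \<le> crystal_phi n i m i A"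
  shows "partial_pow (crystal_f n i m i) c A = Some (A(i := (A i)(i := A i i + c)))"
  using assms(2)
proof (induction c)
  case (Suc c)
  let ?B = "A(i := (A i)(i := A i i + c))"
  have "sum (?B i) {i..n} = sum (A i) {i..n} + c"
    using sum_update_incr[of "{i..n}" "A i" i c] assms(1) by simp
  then have "crystal_phi n i m i ?B = crystal_phi n i m i A - int c"
    by (simp add: crystal_phi_def)
  then have "crystal_f n i m i ?B = Some (incr i i ?B)"
    using Suc.prems by (simp add: crystal_f_def)
  moreover have "incr i i ?B = A(i := (A i)(i := A i i + Suc c))"
    by (auto simp: incr_def fun_eq_iff)
  moreover have "partial_pow (crystal_f n i m i) c A = Some ?B"
    by (rule Suc.IH) (use Suc.prems in simp)
  ultimately show ?case
    by (simp only: partial_pow_Suc Option.bind.simps)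
qed (simp add: fun_eq_iff)

lemma crystal_e_pow_diag:
  assumes "c \<le> A i i"
  shows "partial_pow (crystal_e n i i) c A = Some (A(i := (A i)(i := A i i - c)))"
  using assms
proof (induction c)
  case (Suc c)
  let ?B = "A(i := (A i)(i := A i i - c))"
  have "crystal_e n i i ?B = Some (decr i i ?B)"
    using Suc.prems by (simp add: crystal_e_def crystal_eps_def)
  moreover have "decr i i ?B = A(i := (A i)(i := A i i - Suc c))"
    by (auto simp: decr_def fun_eq_iff)
  moreover have "partial_pow (crystal_e n i i) c A = Some ?B"
    by (rule Suc.IH) (use Suc.prems in simp)
  ultimately show ?case
    by (simp only: partial_pow_Suc Option.bind.simps)
qed (simp add: fun_eq_iff)

section \<open>Comparing the two sides\<close>

locale erased_row =
  fixes n i m k t :: nat and Q :: array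
  assumes i: "1 \<le> i" "i \<le> n" and k: "i \<le> k" "k \<le> n" and t: "1 \<le> t" "t \<le> i"
    and Q: "Q \<in> crystal_B n i m"
    and rows: "q < k \<Longrightarrow> Q p q = 0" and cols: "p < t \<Longrightarrow> Q p k = 0"
    and corner: "Q t k > 0"
begin

text \<open>Index 0 contributes nothing, since row \<open>k\<close> vanishes before column
  \<open>t\<close> and \<open>t\<close> is at least 1.\<close>

definition row_partial :: "nat \<Rightarrow> nat" where
  "row_partial l = (\<Sum>j<l. Q j k)"

definition R :: array where
  "R = erase_row k Q"

definition X :: array where
  "X = (\<lambda>p q. if q = i then Q p k else R p q)"

lemma R_apply: "R p q = (if q \<le> k then 0 else Q p q)"
  using rows by (auto simp: R_def erase_row_def)

lemma X_apply: "X p q = (if q = i then Q p k else if q \<le> k then 0 else Q p q)"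
  by (simp add: X_def R_apply)

lemma X_le: "q \<noteq> i \<Longrightarrow> X p q \<le> Q p q"
  by (simp add: X_apply)

lemma row_partial_Suc: "row_partial (Suc l) = row_partial l + Q l k"
  by (simp add: row_partial_def)

lemma row_partial_t: "l \<le> t \<Longrightarrow> row_partial l = 0"
  using cols by (simp add: row_partial_def)

lemma row_partial_pos: "t \<le> l \<Longrightarrow> row_partial (Suc l) > 0"
  using corner member_le_sum[of t "{..<Suc l}" "\<lambda>j. Q j k"] unfolding row_partial_def by force

lemma sum_R: "p \<in> {k..n} \<Longrightarrow> sum (Q l) {k..p} = Q l k + sum (R l) {i..p}"
proof -
  assume p: "p \<in> {k..n}"
  have "sum (R l) {i..p} = sum (R l) {i..k} + sum (R l) {k<..p}"
    using p k by (intro sum_split_greater) auto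
  also have "\<dots> = sum (Q l) {k<..p}"
    by (simp add: R_apply)
  finally show ?thesis
    using p sum_split_greater[of k k p "Q l"] by simp
qed

text \<open>The path follows column 1 through zero rows down to row \<open>k\<close>, then runs
  along row \<open>k\<close>.\<close>

lemma dyck_prefix_first_row:
  assumes "1 \<le> l"
  shows "dyck_prefix i Q l k (row_partial l)"
proof -
  have "dyck_prefix i Q 1 k (0 + sum (Q 1) {i..<k})"
    using dyck_prefix.start k(1) by (rule dyck_prefix_rows)
  then have "dyck_prefix i Q 1 k 0"
    using rows by simp
  then have "dyck_prefix i Q l k (\<Sum>j=1..<l. Q j k)"
    using dyck_prefix_cols[of i Q 1 k 0 l] assms by simp
  moreover have "(\<Sum>j=1..<l. Q j k) = row_partial l"
    unfolding row_partial_def using cols[of 0] t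
    by (intro sum.mono_neutral_left) (auto simp: not_le less_Suc_eq)
  ultimately show ?thesis by simp
qed

text \<open>\<open>Z\<close> is the array \<open>Z\<^sub>l\<close>, and \<open>relift i l (row_partial l) Z\<close> is \<open>Y\<^sub>l\<close>. The condition on prefixes
  stands in for the inequalities of the crystal: a Dyck path through the original entries that
  enters column \<open>l\<close> may be completed by the current column \<open>l\<close>.\<close>

definition stage :: "nat \<Rightarrow> array \<Rightarrow> bool" where
  "stage l Z \<longleftrightarrow>
    (\<forall>j<l. Z j = X j) \<and> (\<forall>p q. i < q \<and> q \<le> k \<longrightarrow> Z p q = 0) \<and>
    (\<Sum>j=i..n. Z l j) + row_partial l = m \<and>
    (\<forall>p g. k \<le> p \<and> i < p \<and> p \<le> n \<and> dyck_prefix i Q l p g \<longrightarrow> g + (\<Sum>j=p..n. Z l j) \<le> m) \<and>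
    partial_comp (map (\<lambda>j. f_phi n i m j) [l..<i + 1]) R = Some (relift i l (row_partial l) Z) \<and>
    partial_comp (map (\<lambda>j. e_eps_minus n i (Q j k) j) (rev [l..<i + 1])) Z = Some X"

lemma sum_first_entry: "sum f {i..n} = f i + sum f {i<..n}" for f :: "nat \<Rightarrow> nat"
  using sum_split_greater[of i i n f] i by simp

text \<open>This is the Dyck path along row \<open>k\<close> to column \<open>i\<close> and then
  down that column.\<close>

lemma row_column_bound: "row_partial (Suc i) + (\<Sum>j=i..n. R i j) \<le> m"
proof -
  have "dyck_prefix i Q i n (row_partial i + sum (Q i) {k..<n})"
    using dyck_prefix_first_row[OF i(1)] k(2) by (rule dyck_prefix_rows)
  then have "row_partial i + sum (Q i) {k..<n} + Q i n \<le> m"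
    using dyck_prefix_bound[OF Q i] by blast
  moreover have "sum (Q i) {k..<n} + Q i n = sum (Q i) {k..n}"
    using sum_split_less[of n k n "Q i"] k by simp
  ultimately show ?thesis
    using sum_R[of n i] k by (simp add: row_partial_Suc)
qed

lemma crystal_phi_R: "crystal_phi n i m i R = int m - int (\<Sum>j=i..n. R i j)"
  using k by (simp add: crystal_phi_def R_apply)

lemma crystal_f_pow_R:
  assumes "c + (\<Sum>j=i..n. R i j) \<le> m"
  shows "partial_pow (crystal_f n i m i) c R = Some (R(i := (R i)(i := c)))"
  using crystal_f_pow_diag[OF i(2), of c m R] assms k by (simp add: crystal_phi_R R_apply)

text \<open>The power of \<open>f\<close> raises the zero corner of \<open>R\<close> to
  \<open>m\<close> minus the column total; taking off the excess \<open>row_partial i\<close> gives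
  the corner of \<open>Z\<close>.\<close>

lemma stage_i: "stage i (X(i := (X i)(i := m - (\<Sum>j=i..n. R i j) - row_partial i)))"
proof -
  define C where "C = (\<Sum>j=i..n. R i j)"
  define Z where "Z = X(i := (X i)(i := m - C - row_partial i))"
  have C: "row_partial i + Q i k + C \<le> m"
    using row_column_bound by (simp add: row_partial_Suc C_def)
  have "sum (Z i) {i<..n} = sum (R i) {i<..n}"
    by (intro sum.cong) (auto simp: Z_def X_def)
  moreover have "R i i = 0"
    using k by (simp add: R_apply)
  ultimately have "(\<Sum>j=i..n. Z i j) + row_partial i = m"
    using C sum_first_entry[of "R i"] sum_first_entry[of "Z i"] by (simp add: C_def Z_def)
  moreover have "g + (\<Sum>j=p..n. Z i j) \<le> m"
    if p: "k \<le> p" "i < p" "p \<le> n" and g: "dyck_prefix i Q i p g" for p g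
  proof -
    \<comment> \<open>After row \<open>i\<close> the column of \<open>Z\<close> lies below that of
      \<open>Q\<close>, where the prefix completes to a Dyck path.\<close>
    have "(\<Sum>j=p..n. Z i j) \<le> sum (Q i) {p..n}"
      using p X_le by (intro sum_mono) (auto simp: Z_def)
    also have "\<dots> = sum (Q i) {p..<n} + Q i n"
      using sum_split_less[of n p n "Q i"] p by simp
    finally show ?thesis
      using dyck_prefix_bound[OF Q i dyck_prefix_rows[OF g p(3)]] by simp
  qed
  moreover have "f_phi n i m i R = Some (R(i := (R i)(i := m - C)))"
  proof -
    have phi: "crystal_phi n i m i R = int (m - C)"
      using C by (simp add: crystal_phi_R C_def of_nat_diff)
    show ?thesis
      unfolding f_phi_def phi nat_int using C by (intro crystal_f_pow_R) (simp add: C_def)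
  qed
  moreover have "R(i := (R i)(i := m - C)) = relift i i (row_partial i) Z"
  proof (intro ext)
    fix p q
    show "(R(i := (R i)(i := m - C))) p q = relift i i (row_partial i) Z p q"
    proof (cases "p > i")
      case True
      then have "Q p k = 0" using Q by (auto simp: crystal_B_def)
      then show ?thesis using True k by (auto simp: relift_def Z_def X_apply R_apply)
    qed (use C k in \<open>auto simp: relift_def Z_def X_apply R_apply\<close>)
  qed
  moreover have "e_eps_minus n i (Q i k) i Z = Some X"
  proof -
    have Zi: "Q i k \<le> Z i i" using C by (simp add: Z_def)
    then have "e_eps_minus n i (Q i k) i Z = partial_pow (crystal_e n i i) (Z i i - Q i k) Z"
      by (simp add: e_eps_minus_def crystal_eps_def nat_diff_distrib)
    also have "\<dots> = Some (Z(i := (Z i)(i := Q i k)))"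
      using Zi by (subst crystal_e_pow_diag) auto
    also have "Z(i := (Z i)(i := Q i k)) = X"
      by (auto simp: Z_def fun_eq_iff X_def)
    finally show ?thesis .
  qed
  ultimately have "stage i Z"
    unfolding stage_def using k by (auto simp: partial_comp_Cons Z_def X_apply)
  then show ?thesis
    by (simp add: Z_def C_def)
qed

section \<open>The passage from stage \<open>l + 1\<close> to stage \<open>l\<close>\<close>

context
  fixes l Z
  assumes l: "t \<le> l" "l < i" and Z: "stage (Suc l) Z"
begin

definition Y :: array where
  "Y = relift i (Suc l) (row_partial (Suc l)) Z"

lemma Z_col: "j \<le> l \<Longrightarrow> Z j = X j"
  using Z by (simp add: stage_def)

lemma Z_zero: "i < q \<Longrightarrow> q \<le> k \<Longrightarrow> Z p q = 0"
  using Z by (simp add: stage_def)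

lemma Z_tail:
  "k \<le> p \<Longrightarrow> i < p \<Longrightarrow> p \<le> n \<Longrightarrow> dyck_prefix i Q (Suc l) p g \<Longrightarrow> g + (\<Sum>j=p..n. Z (Suc l) j) \<le> m"
  using Z by (simp add: stage_def)

lemma Y_left: "Y l = R l"
  using Z_col[of l] k by (auto simp: Y_def relift_def X_def R_apply fun_eq_iff)

lemma Y_right: "Y (Suc l) = (Z (Suc l))(i := Z (Suc l) i + row_partial (Suc l))"
  by (auto simp: Y_def relift_def fun_eq_iff)

lemma sum_Y_right: "(\<Sum>j=i..n. Y (Suc l) j) = m"
  unfolding Y_right using sum_update_incr[of "{i..n}" "Z (Suc l)" i] i Z
  by (simp add: stage_def)

lemma U_Y_first: "U_sum n i l Y i = m"
  using sum_Y_right k by (simp add: U_sum_def Y_left R_apply)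

text \<open>The path runs along row \<open>k\<close> to column \<open>l\<close>, down to row
  \<open>r\<close>, and over to column \<open>l + 1\<close>. Along row \<open>k\<close> it collects
  \<open>row_partial (Suc l)\<close> besides the entries counted by \<open>U\<close>, so row
  \<open>i\<close> leads by that amount.\<close>

lemma U_Y_later:
  assumes p: "p \<in> {i<..n}"
  shows "U_sum n i l Y p + row_partial (Suc l) \<le> m"
proof -
  \<comment> \<open>For \<open>p < k\<close> the tail of \<open>Z\<close> may start at
    \<open>k\<close> instead, because its rows after \<open>i\<close> up to \<open>k\<close> are
    zero.\<close>
  define r where "r = max k p"
  have r: "k \<le> r" "i < r" "r \<le> n" "p \<le> r"
    using p k by (auto simp: r_def)
  have "sum (Y (Suc l)) {p..n} = sum (Z (Suc l)) {p..n}"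
    using p unfolding Y_right by (intro sum.cong) auto
  also have "\<dots> = sum (Z (Suc l)) {p..<r} + sum (Z (Suc l)) {r..n}"
    using r by (intro sum_split_less) auto
  also have "sum (Z (Suc l)) {p..<r} = 0"
    using p Z_zero by (auto simp: r_def)
  finally have tail: "sum (Y (Suc l)) {p..n} = sum (Z (Suc l)) {r..n}" by simp
  have "dyck_prefix i Q l r (row_partial l + sum (Q l) {k..<r})"
    using dyck_prefix_first_row[of l] l t r(1) by (intro dyck_prefix_rows) auto
  then have "dyck_prefix i Q (Suc l) r (row_partial l + sum (Q l) {k..<r} + Q l r)"
    by (rule dyck_prefix.col_step)
  moreover have "sum (Q l) {k..<r} + Q l r = Q l k + sum (R l) {i..r}"
    using sum_split_less[of r k r "Q l"] sum_R[of r l] r by simp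
  ultimately have "row_partial (Suc l) + sum (R l) {i..r} + sum (Z (Suc l)) {r..n} \<le> m"
    using Z_tail[OF r(1-3), of "row_partial l + (Q l k + sum (R l) {i..r})"]
    by (simp add: row_partial_Suc add.assoc)
  moreover have "sum (R l) {i..p} \<le> sum (R l) {i..r}"
    using r by (intro sum_mono2) auto
  ultimately show ?thesis
    by (simp add: U_sum_def Y_left tail)
qed

text \<open>The excess moves from column \<open>l + 1\<close> to column \<open>l\<close>, where it
  splits into the entry \<open>Q l k\<close> of \<open>Z\<close> and the new excess
  \<open>row_partial l\<close>. The array \<open>Z\<close> stays the same.\<close>

lemma crystal_f_pow_Y:
  "partial_pow (crystal_f n i m l) (row_partial (Suc l)) Y = Some (relift i l (row_partial l) Z)"
proof -
  have "partial_pow (crystal_f n i m l) (row_partial (Suc l)) Y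
    = Some (Y(l := (Y l)(i := Y l i + row_partial (Suc l)),
        l + 1 := (Y (l + 1))(i := Y (l + 1) i - row_partial (Suc l))))"
    using U_Y_later U_Y_first by (intro crystal_f_pow_first_row[OF l(2) i(2)]) (auto simp: Y_right)
  also have "Y(l := (Y l)(i := Y l i + row_partial (Suc l)),
        l + 1 := (Y (l + 1))(i := Y (l + 1) i - row_partial (Suc l))) = relift i l (row_partial l) Z"
    (is "?L = ?R")
  proof (intro ext)
    fix p q
    show "?L p q = ?R p q"
      using Z_col[of l] k
      by (auto simp: Y_left R_apply row_partial_Suc X_apply Y_right relift_def Y_def)
  qed
  finally show ?thesis .
qed

lemma crystal_phi_Y: "crystal_phi n i m l Y = int m - int (\<Sum>j=i..n. R l j)"
proof -
  have less: "U_sum n i l Y p < U_sum n i l Y i" if "p \<in> {i<..n}" for p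
    using U_Y_later[OF that] row_partial_pos[OF l(1)] by (simp add: U_Y_first)
  have "p_minus n i l Y = i"
    using less i by (intro p_minus_eqI) (force simp: le_less)+
  then show ?thesis
    by (simp add: crystal_phi_col[OF l(2) i(2)] U_Y_first Y_left)
qed

text \<open>Without the excess, \<open>U\<close> at row \<open>i\<close> is still a maximum by
  \<open>U_Y_later\<close>. Hence an exponent of \<open>eps\<close> minus \<open>Q l k\<close>
  undoes exactly the steps of \<open>f\<close> that start from \<open>Z\<close>.\<close>

lemma crystal_eps_Z: "crystal_eps n i l Z = int (Q l k)"
proof -
  have first: "U_sum n i l Z i = Q l k + (\<Sum>j=i..n. Z (Suc l) j)"
    using Z_col[of l] by (simp add: U_sum_def X_apply)
  have later: "U_sum n i l Z p = Q l k + U_sum n i l Y p" if p: "p \<in> {i<..n}" for p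
  proof -
    have "Z l = (Y l)(i := Y l i + Q l k)"
      unfolding Y_left using Z_col[of l] k by (auto simp: X_def R_apply fun_eq_iff)
    then have "sum (Z l) {i..p} = sum (Y l) {i..p} + Q l k"
      using sum_update_incr[of "{i..p}" "Y l" i "Q l k"] p by simp
    moreover have "sum (Z (Suc l)) {p..n} = sum (Y (Suc l)) {p..n}"
      using p unfolding Y_right by (intro sum.cong) auto
    ultimately show ?thesis by (simp add: U_sum_def)
  qed
  have sum: "(\<Sum>j=i..n. Z (Suc l) j) + row_partial (Suc l) = m"
    using Z by (simp add: stage_def)
  have "U_sum n i l Z p \<le> U_sum n i l Z i" if "p \<in> {i..n}" for p
    using that first later[of p] U_Y_later[of p] sum by (cases "p = i") auto
  then have "q_minus n i l Z = i"
    using i by (intro q_minus_eqI) auto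
  then show ?thesis
    by (simp add: crystal_eps_col[OF l(2) i(2)] first)
qed

lemma stage_step: "\<exists>Z'. stage l Z'"
proof -
  define C where "C = (\<Sum>j=i..n. R l j)"
  define N where "N = m - C - row_partial (Suc l)"
  note phi = crystal_phi_crystal_f_pow[OF l(2) i(2) crystal_f_pow_Y, unfolded crystal_phi_Y, folded C_def]
  \<comment> \<open>After the first phase \<open>phi\<close> is still nonnegative; \<open>N\<close>
    counts the applications that remain.\<close>
  have C: "C + row_partial (Suc l) \<le> m"
    using phi crystal_phi_nonneg[OF l(2) i(2), of m "relift i l (row_partial l) Z"] by linarith
  then have "int N \<le> crystal_phi n i m l (relift i l (row_partial l) Z)"
    unfolding phi by (simp add: N_def of_nat_diff)
  then obtain Y' where Y': "partial_pow (crystal_f n i m l) N (relift i l (row_partial l) Z) = Some Y'"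
    using crystal_f_pow_defined[OF l(2) i(2)] by blast
  \<comment> \<open>The second phase commutes with \<open>relift\<close>, so it can be carried out
    on \<open>Z\<close>.\<close>
  then obtain Z' where Z': "partial_pow (crystal_f n i m l) N Z = Some Z'"
    and rel: "Y' = relift i l (row_partial l) Z'"
    by (auto simp: crystal_f_pow_relift[OF l(2) i(2)])
  note keep = crystal_f_pow_preserves[OF l(2) i(2) Z']
  have "f_phi n i m l Y = Some (relift i l (row_partial l) Z')"
  proof -
    have "nat (crystal_phi n i m l Y) = row_partial (Suc l) + N"
      using C by (simp add: crystal_phi_Y C_def N_def)
    then show ?thesis
      using Y' rel by (simp add: f_phi_def partial_pow_add crystal_f_pow_Y)
  qed
  then have F: "partial_comp (map (\<lambda>j. f_phi n i m j) [l..<i + 1]) R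
      = Some (relift i l (row_partial l) Z')"
    using Z l(2) by (simp add: stage_def Y_def upt_conv_Cons[of l] partial_comp_Cons del: upt_Suc)
  have "e_eps_minus n i (Q l k) l Z' = Some Z"
    using crystal_eps_crystal_f_pow[OF l(2) i(2) Z'] crystal_e_pow_crystal_f_pow[OF l(2) i(2) Z']
    by (simp add: e_eps_minus_def crystal_eps_Z)
  then have E: "partial_comp (map (\<lambda>j. e_eps_minus n i (Q j k) j) (rev [l..<i + 1])) Z' = Some X"
    using Z l(2) by (simp add: stage_def upt_conv_Cons[of l] partial_comp_snoc del: upt_Suc)
  have "(\<Sum>j=i..n. Z' l j) + row_partial l = m"
  proof -
    have "Z l = (R l)(i := R l i + Q l k)"
      using Z_col[of l] k by (auto simp: X_def R_apply fun_eq_iff)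
    then have "(\<Sum>j=i..n. Z l j) = C + Q l k"
      using sum_update_incr[of "{i..n}" "R l" i "Q l k"] i by (simp add: C_def)
    then show ?thesis
      using sum_crystal_f_pow[OF l(2) i(2) Z'] C by (simp add: N_def row_partial_Suc)
  qed
  moreover have "g + (\<Sum>j=p..n. Z' l j) \<le> m"
    if p: "k \<le> p" "i < p" "p \<le> n" and g: "dyck_prefix i Q l p g" for p g
  proof -
    \<comment> \<open>The prefix is continued down column \<open>l\<close> of \<open>Q\<close>,
      which dominates \<open>Z\<close> there, and crosses to column \<open>l + 1\<close> in row
      \<open>r\<close>.\<close>
    have bound: "g + ((\<Sum>j=p..r. Z l j) + (\<Sum>j=r..n. Z (l + 1) j)) \<le> m" if r: "r \<in> {p..n}" for r
    proof -
      have "dyck_prefix i Q (Suc l) r (g + sum (Q l) {p..<r} + Q l r)"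
        using r by (intro dyck_prefix.col_step dyck_prefix_rows[OF g]) auto
      moreover have "sum (Q l) {p..<r} + Q l r = sum (Q l) {p..r}"
        using sum_split_less[of r p r "Q l"] r by simp
      moreover have "sum (Z l) {p..r} \<le> sum (Q l) {p..r}"
        using Z_col[of l] X_le p by (intro sum_mono) auto
      ultimately show ?thesis
        using Z_tail[of r "g + sum (Q l) {p..r}"] p r by (simp add: add.assoc)
    qed
    have "(\<Sum>j=p..n. Z' l j) + (\<Sum>j=n..n. Z' (l + 1) j) \<le> m - g"
    proof (rule tail_bound_crystal_f_pow[OF l(2) i(2) Z'])
      show "(\<Sum>j=p..r. Z l j) + (\<Sum>j=r..n. Z (l + 1) j) \<le> m - g" if "r \<in> {p..n}" for r
        using bound[OF that] by linarith
    qed (use p in auto)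
    \<comment> \<open>The case \<open>n\<close> of \<open>bound\<close> gives
      \<open>g \<le> m\<close>, so \<open>m - g\<close> was not truncated.\<close>
    then show ?thesis
      using bound[of n] p by simp
  qed
  moreover have "Z' j = X j" if "j < l" for j
    using that Z_col[of j] keep(2)[of j] by simp
  moreover have "Z' p q = 0" if "i < q" "q \<le> k" for p q
  proof (cases "p = l \<or> p = l + 1")
    case True
    have "Z' l q + Z' (l + 1) q = 0"
      using keep(1)[of q] Z_zero[OF that] by simp
    then show ?thesis using True by auto
  next
    case False
    then show ?thesis using keep(2)[of p] Z_zero[OF that] by simp
  qed
  ultimately have "stage l Z'"
    unfolding stage_def using E F by (intro conjI allI impI) auto
  then show ?thesis by (rule exI[of _ Z'])
qed

end

section \<open>The composition of all factors\<close>

lemma stage_exists: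
  assumes "t < i"
  shows "\<exists>Z. stage (t + 1) Z"
proof -
  have "Suc t \<le> i" using assms by simp
  then have "\<exists>Z. stage (Suc t) Z"
  proof (induction rule: inc_induct)
    case base
    then show ?case using stage_i by blast
  next
    case (step l)
    then show ?case using stage_step[of l] by auto
  qed
  then show ?thesis by simp
qed

lemma op_E_op_F: "(op_E n i k t Q \<circ>\<^sub>m op_F n i m k t Q) R = Some X"
proof (cases "t = i")
  case True
  \<comment> \<open>Here \<open>E\<close> is an empty composition and \<open>F\<close> a single
    power of \<open>f\<close> at the corner.\<close>
  have "partial_pow (crystal_f n i m i) (Q i k) R = Some (R(i := (R i)(i := Q i k)))"
    using row_column_bound by (intro crystal_f_pow_R) (simp add: row_partial_Suc)
  moreover have "R(i := (R i)(i := Q i k)) = X"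
  proof (intro ext)
    fix p q
    have "Q p k = 0" if "p \<noteq> i"
      using that Q cols[of p] True by (cases "p < i") (auto simp: crystal_B_def)
    then show "(R(i := (R i)(i := Q i k))) p q = X p q"
      using k by (auto simp: X_apply R_apply)
  qed
  ultimately show ?thesis
    using True by (simp add: op_E_def op_F_def map_comp_def)
next
  case False
  then have ti: "t < i" using t by simp
  then obtain Z where Z: "stage (Suc t) Z"
    using stage_exists by auto
  \<comment> \<open>The exponent of the last factor of \<open>F\<close> is the length of the first
    phase at \<open>t\<close>, and no excess is left over afterwards.\<close>
  have Q_t: "row_partial (Suc t) = Q t k" "row_partial t = 0"
    by (simp_all add: row_partial_Suc row_partial_t)
  have "relift i t 0 Z = Z"
  proof (intro ext)
    fix p q
    show "relift i t 0 Z p q = Z p q"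
      using Z cols[of p] by (auto simp: relift_def stage_def X_apply)
  qed
  then have "partial_pow (crystal_f n i m t) (Q t k) (relift i (Suc t) (Q t k) Z) = Some Z"
    using crystal_f_pow_Y[OF order.refl ti Z] by (simp add: Y_def[OF order.refl ti Z] Q_t)
  then have "op_F n i m k t Q R = Some Z"
    using Z by (simp add: op_F_def stage_def Q_t del: upt_Suc)
  then show ?thesis
    using Z by (simp add: op_E_def stage_def map_comp_def del: upt_Suc)
qed

lemma op_H_X: "op_H n i m k X = Some Q"
proof -
  have "op_H n i m k X = Some (\<lambda>p q. if q = k then X p i else if q = i then 0 else X p q)"
    using i(1) k(1)
  proof (rule op_H_row)
    show "X p i = 0" if "p \<notin> {1..i}" for p
      using that Q by (auto simp: X_apply crystal_B_def)
  qed (simp add: X_apply)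
  also have "(\<lambda>p q. if q = k then X p i else if q = i then 0 else X p q) = Q"
    using rows k by (auto simp: X_apply fun_eq_iff)
  finally show ?thesis .
qed

end

theorem theorem3p1:
  fixes n i m :: nat and Q :: array
  assumes "n \<ge> 1" and "1 \<le> i" and "i \<le> n" and "m \<ge> 1"
    and "Q \<in> crystal_B n i m" and "\<exists>p q. Q p q \<noteq> 0"
  shows "op_K n i m Q (erase_row (first_row Q) Q) = Some Q"
proof -
  define k where "k = first_row Q"
  define t where "t = first_col Q"
  have "Q p q = 0" if "p \<notin> {1..i} \<or> q \<notin> {i..n}" for p q
    using assms(5) that by (simp add: crystal_B_def)
  then have supp: "p \<in> {1..i} \<and> q \<in> {i..n}" if "Q p q \<noteq> 0" for p q
    using that by metis
  have "\<exists>k p. Q p k \<noteq> 0"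
    using assms(6) by blast
  then have "\<exists>p. Q p k \<noteq> 0"
    unfolding k_def first_row_def by (rule LeastI_ex)
  then have tk: "Q t k \<noteq> 0"
    unfolding t_def first_col_def k_def by (rule LeastI_ex)
  interpret erased_row n i m k t Q
  proof
    show "Q p q = 0" if "q < k" for p q
      using that not_less_Least[of q "\<lambda>k. \<exists>p. Q p k \<noteq> 0"] by (auto simp: k_def first_row_def)
    show "Q p k = 0" if "p < t" for p
      using that not_less_Least[of p "\<lambda>p. Q p k \<noteq> 0"] by (auto simp: t_def k_def first_col_def)
  qed (use assms supp[OF tk] tk in auto)
  show ?thesis
    unfolding op_K_def Let_def k_def[symmetric] t_def[symmetric] R_def[symmetric]
    by (simp add: map_comp_def[of "op_H n i m k"] op_E_op_F op_H_X)
qed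

end
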